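(* Let $P$ be a dcpo, and let $G$ be a set of Scott-continuous preclosure maps on $P$. The (pointwise calculated) directed join $h:=\bigvee G^*$ in $\mathrm{ScPrecl}(P)$ exists and is a Scott-continuous closure operator on $P$. Moreover, $h$ is the closure operator on the dcpo $P$ generated by the set $G$ of preclosure maps on $P$, therefore $\mathrm{fix}(h)=\mathrm{fix}(G)$.
   Context: A dcpo is a poset in which every directed (in particular nonempty) subset has a join. A preclosure map on $P$ is a map $f:P\to P$ that is increasing and ascending ($x\le f(x)$ for all $x$); a closure operator is an idempotent preclosure map. A map between posets is Scott-continuous if it preserves all existing joins of directed subsets. $\mathrm{ScPrecl}(P)$ is the set of all Scott-continuous preclosure maps on $P$, ordered pointwise; it is a monoid under composition with neutral element $\mathrm{id}_P$. $G^*$ denotes the submonoid generated by $G$, i.e. the set of all finite composites of elements of $G$, including $\mathrm{id}_P$ (it is a directed subset of $\mathrm{ScPrecl}(P)$). "Pointwise calculated" means $h(x)=\bigvee\{u(x): u\in G^*\}$ for every $x\in P$. For a set $F$ of maps $P\to P$, $\mathrm{fix}(F)=\{x\in P: f(x)=x\text{ for all }f\in F\}$, and $\mathrm{fix}(h)=\mathrm{fix}(\{h\})$. For a set $G$ of preclosure maps on a dcpo $P$, the closure operator generated by $G$ is the (unique) closure operator on $P$ whose fixpoint set is $\mathrm{fix}(G)$; it is the least closure operator $k$ on $P$ with $k\ge g$ for every $g\in G$. *)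

theory Defs
  imports "HOL-Algebra.Complete_Lattice" "HOL-Algebra.Group"
begin

definition directed_set :: "('a, 'm) gorder_scheme \<Rightarrow> 'a set \<Rightarrow> bool" where
  "directed_set P D \<longleftrightarrow>
     D \<subseteq> carrier P \<and> D \<noteq> {} \<and>
     (\<forall>x\<in>D. \<forall>y\<in>D. \<exists>z\<in>D. x \<sqsubseteq>\<^bsub>P\<^esub> z \<and> y \<sqsubseteq>\<^bsub>P\<^esub> z)"

locale dcpo = partial_order P for P (structure) +
  assumes directed_lub: "directed_set P D \<Longrightarrow> \<exists>s. is_lub P s D"

definition scott_continuous ::
  "('a, 'm) gorder_scheme \<Rightarrow> ('b, 'n) gorder_scheme \<Rightarrow> ('a \<Rightarrow> 'b) \<Rightarrow> bool" where
  "scott_continuous P Q f \<longleftrightarrow>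
     f \<in> carrier P \<rightarrow> carrier Q \<and>
     (\<forall>D s. directed_set P D \<and> is_lub P s D \<longrightarrow> is_lub Q (f s) (f ` D))"

text \<open>Maps \<open>P \<rightarrow> P\<close> are extensional functions, so that two maps are equal as HOL functions
  iff they agree on the carrier. Accordingly, the composition and the identity below are
  \<^const>\<open>compose\<close> and the identity restricted to the carrier.\<close>

definition preclosure_map :: "('a, 'm) gorder_scheme \<Rightarrow> ('a \<Rightarrow> 'a) \<Rightarrow> bool" where
  "preclosure_map P f \<longleftrightarrow>
     f \<in> carrier P \<rightarrow>\<^sub>E carrier P \<and> isotone P P f \<and> (\<forall>x\<in>carrier P. x \<sqsubseteq>\<^bsub>P\<^esub> f x)"

definition closure_operator :: "('a, 'm) gorder_scheme \<Rightarrow> ('a \<Rightarrow> 'a) \<Rightarrow> bool" where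
  "closure_operator P f \<longleftrightarrow> preclosure_map P f \<and> Idem\<^bsub>P\<^esub> f"

definition scott_preclosure_maps :: "('a, 'm) gorder_scheme \<Rightarrow> ('a \<Rightarrow> 'a) set" where
  "scott_preclosure_maps P = {f. preclosure_map P f \<and> scott_continuous P P f}"

definition pointwise_le :: "('a, 'm) gorder_scheme \<Rightarrow> ('a \<Rightarrow> 'a) \<Rightarrow> ('a \<Rightarrow> 'a) \<Rightarrow> bool" where
  "pointwise_le P f g \<longleftrightarrow> (\<forall>x\<in>carrier P. f x \<sqsubseteq>\<^bsub>P\<^esub> g x)"

definition ScPrecl :: "('a, 'm) gorder_scheme \<Rightarrow> ('a \<Rightarrow> 'a) gorder" where
  "ScPrecl P = \<lparr>carrier = scott_preclosure_maps P, eq = (=), le = pointwise_le P\<rparr>"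

definition ScPrecl_monoid :: "('a, 'm) gorder_scheme \<Rightarrow> ('a \<Rightarrow> 'a) monoid" where
  "ScPrecl_monoid P =
     \<lparr>carrier = scott_preclosure_maps P, mult = compose (carrier P), one = (\<lambda>x\<in>carrier P. x)\<rparr>"

definition generated_submonoid :: "('a, 'm) monoid_scheme \<Rightarrow> 'a set \<Rightarrow> 'a set" where
  "generated_submonoid M G = {foldr (\<otimes>\<^bsub>M\<^esub>) gs \<one>\<^bsub>M\<^esub> | gs. set gs \<subseteq> G}"

definition fixpoints :: "('a, 'm) gorder_scheme \<Rightarrow> ('a \<Rightarrow> 'a) set \<Rightarrow> 'a set" where
  "fixpoints P F = {x \<in> carrier P. \<forall>f\<in>F. f x = x}"

text \<open>By \<open>closure_operator_eqI\<close> below, there is at most one such \<open>k\<close>; by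
  \<open>closure_operator_generated_by_least\<close>, it is the least closure operator above all
  members of \<open>G\<close>.\<close>

definition closure_operator_generated_by ::
  "('a, 'm) gorder_scheme \<Rightarrow> ('a \<Rightarrow> 'a) set \<Rightarrow> ('a \<Rightarrow> 'a) \<Rightarrow> bool" where
  "closure_operator_generated_by P G k \<longleftrightarrow>
     closure_operator P k \<and> fixpoints P {k} = fixpoints P G"

context partial_order
begin

lemma fixpoints_singleton: "fixpoints L {f} = fps L f"
  by (simp add: fixpoints_def fps_def eq_is_equal)

lemma closure_operator_le_iff:
  assumes h: "closure_operator L h" and k: "closure_operator L k"
  shows "pointwise_le L h k \<longleftrightarrow> fixpoints L {k} \<subseteq> fixpoints L {h}"
proof -
  have hc: "h x \<in> carrier L" "x \<sqsubseteq> h x" "h (h x) = h x" if "x \<in> carrier L" for x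
    using h that
    by (auto simp: closure_operator_def preclosure_map_def idempotent_def eq_is_equal)
  have kc: "k x \<in> carrier L" "x \<sqsubseteq> k x" "k (k x) = k x" if "x \<in> carrier L" for x
    using k that
    by (auto simp: closure_operator_def preclosure_map_def idempotent_def eq_is_equal)
  have mono: "h x \<sqsubseteq> h y" if "x \<in> carrier L" "y \<in> carrier L" "x \<sqsubseteq> y" for x y
    using h that by (auto simp: closure_operator_def preclosure_map_def isotone_def)
  show ?thesis
  proof
    assume "pointwise_le L h k"
    then show "fixpoints L {k} \<subseteq> fixpoints L {h}"
      using hc by (fastforce simp: pointwise_le_def fixpoints_def)
  next
    assume sub: "fixpoints L {k} \<subseteq> fixpoints L {h}"
    show "pointwise_le L h k"
      unfolding pointwise_le_def
    proof
      fix x assume x: "x \<in> carrier L"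
      then have "k x \<in> fixpoints L {k}"
        using kc by (simp add: fixpoints_def)
      then have "h (k x) = k x"
        using sub by (auto simp: fixpoints_def)
      then show "h x \<sqsubseteq> k x"
        using mono[of x "k x"] kc x by auto
    qed
  qed
qed

lemma closure_operator_eqI:
  assumes h: "closure_operator L h" and k: "closure_operator L k"
    and eq: "fixpoints L {h} = fixpoints L {k}"
  shows "h = k"
proof (rule extensionalityI)
  show "h \<in> extensional (carrier L)" "k \<in> extensional (carrier L)"
    using h k by (auto simp: closure_operator_def preclosure_map_def PiE_iff)
  fix x assume x: "x \<in> carrier L"
  have "pointwise_le L h k" "pointwise_le L k h"
    using eq closure_operator_le_iff h k by auto
  moreover have "h x \<in> carrier L" "k x \<in> carrier L"
    using h k x by (auto simp: closure_operator_def preclosure_map_def)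
  ultimately show "h x = k x"
    using x by (auto simp: pointwise_le_def)
qed

lemma closure_operator_generated_by_least:
  assumes G: "\<And>g. g \<in> G \<Longrightarrow> preclosure_map L g"
    and k: "closure_operator_generated_by L G k"
  shows "\<And>g. g \<in> G \<Longrightarrow> pointwise_le L g k"
    and "\<And>k'. closure_operator L k' \<Longrightarrow> (\<And>g. g \<in> G \<Longrightarrow> pointwise_le L g k') \<Longrightarrow>
           pointwise_le L k k'"
proof -
  have kcl: "closure_operator L k" and fk: "fixpoints L {k} = fixpoints L G"
    using k by (auto simp: closure_operator_generated_by_def)
  have kc: "k x \<in> carrier L" "x \<sqsubseteq> k x" "k (k x) = k x" if "x \<in> carrier L" for x
    using kcl that
    by (auto simp: closure_operator_def preclosure_map_def idempotent_def eq_is_equal)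
  have gc: "g x \<in> carrier L" "x \<sqsubseteq> g x" if "g \<in> G" "x \<in> carrier L" for g x
    using G that by (auto simp: preclosure_map_def)
  have mono: "g x \<sqsubseteq> g y" if "g \<in> G" "x \<in> carrier L" "y \<in> carrier L" "x \<sqsubseteq> y" for g x y
    using G[OF that(1)] that by (auto simp: preclosure_map_def isotone_def)
  show "pointwise_le L g k" if "g \<in> G" for g
    unfolding pointwise_le_def
  proof
    fix x assume x: "x \<in> carrier L"
    then have "k x \<in> fixpoints L G"
      using kc fk by (auto simp: fixpoints_def)
    then have "g (k x) = k x"
      using that by (auto simp: fixpoints_def)
    then show "g x \<sqsubseteq> k x"
      using mono[of g x "k x"] that kc x by auto
  qed
  show "pointwise_le L k k'"
    if k': "closure_operator L k'" and ge: "\<And>g. g \<in> G \<Longrightarrow> pointwise_le L g k'" for k'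
  proof -
    have "fixpoints L {k'} \<subseteq> fixpoints L G"
      using ge gc by (fastforce simp: pointwise_le_def fixpoints_def)
    then show ?thesis
      using closure_operator_le_iff[OF kcl k'] fk by simp
  qed
qed

lemma partial_order_ScPrecl: "partial_order (ScPrecl L)"
proof
  fix f g
  assume "f \<sqsubseteq>\<^bsub>ScPrecl L\<^esub> g" "g \<sqsubseteq>\<^bsub>ScPrecl L\<^esub> f"
    and "f \<in> carrier (ScPrecl L)" "g \<in> carrier (ScPrecl L)"
  then have le: "pointwise_le L f g" "pointwise_le L g f"
    and pc: "preclosure_map L f" "preclosure_map L g"
    by (auto simp: ScPrecl_def scott_preclosure_maps_def)
  have "f = g"
  proof (rule extensionalityI)
    show "f \<in> extensional (carrier L)" "g \<in> extensional (carrier L)"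
      using pc by (auto simp: preclosure_map_def PiE_iff)
    show "f x = g x" if "x \<in> carrier L" for x
      using le pc that by (fastforce simp: pointwise_le_def preclosure_map_def)
  qed
  then show "f .=\<^bsub>ScPrecl L\<^esub> g"
    by (simp add: ScPrecl_def)
next
  fix f g h
  assume "f \<sqsubseteq>\<^bsub>ScPrecl L\<^esub> g" "g \<sqsubseteq>\<^bsub>ScPrecl L\<^esub> h"
    "f \<in> carrier (ScPrecl L)" "g \<in> carrier (ScPrecl L)" "h \<in> carrier (ScPrecl L)"
  then show "f \<sqsubseteq>\<^bsub>ScPrecl L\<^esub> h"
    unfolding ScPrecl_def scott_preclosure_maps_def pointwise_le_def preclosure_map_def
    by simp (meson PiE_mem le_trans)
qed (auto simp: ScPrecl_def scott_preclosure_maps_def pointwise_le_def preclosure_map_def)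

lemma monoid_ScPrecl: "monoid (ScPrecl_monoid L)"
proof -
  let ?S = "scott_preclosure_maps L"
  have comp: "compose (carrier L) g f \<in> ?S" if f: "f \<in> ?S" and g: "g \<in> ?S" for f g
  proof -
    have fc: "\<And>x. x \<in> carrier L \<Longrightarrow> f x \<in> carrier L \<and> x \<sqsubseteq> f x"
      and gc: "\<And>x. x \<in> carrier L \<Longrightarrow> g x \<in> carrier L \<and> x \<sqsubseteq> g x"
      and fm: "\<And>x y. x \<in> carrier L \<Longrightarrow> y \<in> carrier L \<Longrightarrow> x \<sqsubseteq> y \<Longrightarrow> f x \<sqsubseteq> f y"
      and gm: "\<And>x y. x \<in> carrier L \<Longrightarrow> y \<in> carrier L \<Longrightarrow> x \<sqsubseteq> y \<Longrightarrow> g x \<sqsubseteq> g y"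
      using f g by (auto simp: scott_preclosure_maps_def preclosure_map_def isotone_def)
    have "preclosure_map L (compose (carrier L) g f)"
      unfolding preclosure_map_def isotone_def
    proof (intro conjI ballI impI)
      show "compose (carrier L) g f \<in> carrier L \<rightarrow>\<^sub>E carrier L"
        using fc gc by (auto simp: compose_def)
      show "compose (carrier L) g f x \<sqsubseteq> compose (carrier L) g f y"
        if "x \<in> carrier L" "y \<in> carrier L" "x \<sqsubseteq> y" for x y
        using that fc fm gm by (simp add: compose_eq)
      show "x \<sqsubseteq> compose (carrier L) g f x" if "x \<in> carrier L" for x
        using that fc gc le_trans[of x "f x" "g (f x)"] by (simp add: compose_eq)
    qed (rule weak_partial_order_axioms)+
    moreover have "is_lub L (compose (carrier L) g f s) (compose (carrier L) g f ` D)"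
      if D: "directed_set L D" "is_lub L s D" for D s
    proof -
      have DL: "D \<subseteq> carrier L" and s: "s \<in> carrier L"
        using D by (auto simp: directed_set_def)
      have img: "compose (carrier L) g f ` D = g ` f ` D"
        using DL by (force simp: compose_def)
      have "directed_set L (f ` D)"
        unfolding directed_set_def
      proof (intro conjI ballI)
        show "f ` D \<subseteq> carrier L"
          using DL fc by auto
        show "f ` D \<noteq> {}"
          using D(1) by (simp add: directed_set_def)
        fix a b assume "a \<in> f ` D" "b \<in> f ` D"
        then obtain x y where xy: "x \<in> D" "y \<in> D" "a = f x" "b = f y"
          by blast
        then obtain z where "z \<in> D" "x \<sqsubseteq> z" "y \<sqsubseteq> z"
          using D(1) unfolding directed_set_def by blast
        then have "f z \<in> f ` D" "a \<sqsubseteq> f z" "b \<sqsubseteq> f z"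
          using xy DL fm by (simp_all add: subsetD)
        then show "\<exists>c\<in>f ` D. a \<sqsubseteq> c \<and> b \<sqsubseteq> c"
          by (intro bexI[of _ "f z"]) simp_all
      qed
      moreover have "is_lub L (f s) (f ` D)"
        using f D by (auto simp: scott_preclosure_maps_def scott_continuous_def)
      ultimately have "is_lub L (g (f s)) (g ` f ` D)"
        using g by (auto simp: scott_preclosure_maps_def scott_continuous_def)
      then show ?thesis
        using s by (simp only: img compose_eq)
    qed
    ultimately show ?thesis
      using fc gc
      by (auto simp: scott_preclosure_maps_def scott_continuous_def compose_def)
  qed
  have one: "(\<lambda>x\<in>carrier L. x) \<in> ?S"
  proof -
    have "(\<lambda>x\<in>carrier L. x) ` D = D" if "D \<subseteq> carrier L" for D
      using that by force
    then show ?thesis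
      using weak_partial_order_axioms
      by (auto simp: scott_preclosure_maps_def preclosure_map_def isotone_def
          scott_continuous_def directed_set_def)
  qed
  have ext: "f \<in> extensional (carrier L)" "f \<in> carrier L \<rightarrow> carrier L" if "f \<in> ?S" for f
    using that by (auto simp: scott_preclosure_maps_def preclosure_map_def PiE_iff)
  have unit: "compose (carrier L) (\<lambda>x\<in>carrier L. x) f = f" "compose (carrier L) f (\<lambda>x\<in>carrier L. x) = f"
    if "f \<in> ?S" for f
    using Id_compose[OF ext(2) ext(1)] compose_Id[OF ext(2) ext(1)] that by auto
  show ?thesis
  proof
    fix f g h
    assume "f \<in> carrier (ScPrecl_monoid L)" "g \<in> carrier (ScPrecl_monoid L)"
      "h \<in> carrier (ScPrecl_monoid L)"
    then show "f \<otimes>\<^bsub>ScPrecl_monoid L\<^esub> g \<otimes>\<^bsub>ScPrecl_monoid L\<^esub> h =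
        f \<otimes>\<^bsub>ScPrecl_monoid L\<^esub> (g \<otimes>\<^bsub>ScPrecl_monoid L\<^esub> h)"
      using ext by (simp add: ScPrecl_monoid_def compose_assoc[symmetric])
  qed (use comp one unit in \<open>auto simp: ScPrecl_monoid_def\<close>)
qed

end

lemma (in monoid) generated_submonoid_least:
  assumes "A \<subseteq> carrier G"
  shows "submonoid (generated_submonoid G A) G"
    and "A \<subseteq> generated_submonoid G A"
    and "\<And>H. submonoid H G \<Longrightarrow> A \<subseteq> H \<Longrightarrow> generated_submonoid G A \<subseteq> H"
proof -
  have closed: "foldr (\<otimes>) xs \<one> \<in> carrier G" if "set xs \<subseteq> A" for xs
    using that assms by (induction xs) auto
  have app: "foldr (\<otimes>) (xs @ ys) \<one> = foldr (\<otimes>) xs \<one> \<otimes> foldr (\<otimes>) ys \<one>"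
    if "set xs \<subseteq> A" "set ys \<subseteq> A" for xs ys
    using that(1)
  proof (induction xs)
    case Nil
    then show ?case using closed[OF that(2)] by simp
  next
    case (Cons x xs)
    then show ?case
      using closed[of xs] closed[OF that(2)] assms by (auto simp: m_assoc)
  qed
  show "submonoid (generated_submonoid G A) G"
  proof
    show "generated_submonoid G A \<subseteq> carrier G"
      using closed by (auto simp: generated_submonoid_def)
    show "\<one> \<in> generated_submonoid G A"
      unfolding generated_submonoid_def by (auto intro!: exI[of _ "[]"])
    fix x y assume "x \<in> generated_submonoid G A" "y \<in> generated_submonoid G A"
    then obtain xs ys where "set xs \<subseteq> A" "set ys \<subseteq> A"
      "x = foldr (\<otimes>) xs \<one>" "y = foldr (\<otimes>) ys \<one>"
      by (auto simp: generated_submonoid_def)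
    then show "x \<otimes> y \<in> generated_submonoid G A"
      unfolding generated_submonoid_def
      by (intro CollectI exI[of _ "xs @ ys"]) (simp add: app del: foldr_append)
  qed
  show "A \<subseteq> generated_submonoid G A"
  proof
    fix a assume "a \<in> A"
    then show "a \<in> generated_submonoid G A"
      unfolding generated_submonoid_def using assms
      by (intro CollectI exI[of _ "[a]"]) auto
  qed
  show "generated_submonoid G A \<subseteq> H" if H: "submonoid H G" and AH: "A \<subseteq> H" for H
  proof -
    have "foldr (\<otimes>) xs \<one> \<in> H" if "set xs \<subseteq> A" for xs
      using that AH submonoid.m_closed[OF H] submonoid.one_closed[OF H] by (induction xs) auto
    then show ?thesis
      by (auto simp: generated_submonoid_def)
  qed
qed

end

theory Submission
  imports Defs
begin

text \<open>The pointwise join of a directed set of Scott-continuous preclosure maps is again one, because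
  joins commute with joins. If the directed set is a submonoid with join \<open>h\<close>, then, by continuity of
  \<open>h\<close>, \<open>h (h x)\<close> is the join of all \<open>v (u x)\<close>, and these lie below \<open>h x\<close>; hence \<open>h\<close> is
  idempotent. A point fixed by all generators is fixed by all their composites, hence by \<open>h\<close>;
  conversely, \<open>x \<sqsubseteq> g x \<sqsubseteq> h x\<close> for every generator \<open>g\<close>.\<close>

text \<open>\<open>Upper\<close> tests only those elements of \<open>A\<close> that lie in the
  carrier. The inclusion \<open>A \<subseteq> carrier L\<close> removes that restriction and leaves
  the textbook description of a join.\<close>

lemma is_lub_iff:
  assumes "A \<subseteq> carrier L"
  shows "is_lub L s A \<longleftrightarrow> s \<in> carrier L \<and> (\<forall>a\<in>A. a \<sqsubseteq>\<^bsub>L\<^esub> s) \<and>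
    (\<forall>b\<in>carrier L. (\<forall>a\<in>A. a \<sqsubseteq>\<^bsub>L\<^esub> b) \<longrightarrow> s \<sqsubseteq>\<^bsub>L\<^esub> b)"
proof -
  have "a \<in> A \<and> a \<in> carrier L \<longleftrightarrow> a \<in> A" for a
    using assms by blast
  then show ?thesis
    using assms by (simp add: least_def Upper_def Ball_def) blast
qed

lemma is_lubD:
  assumes "is_lub L s A"
  shows "s \<in> carrier L"
    and "\<And>a. a \<in> A \<Longrightarrow> a \<in> carrier L \<Longrightarrow> a \<sqsubseteq>\<^bsub>L\<^esub> s"
    and "\<And>b. b \<in> carrier L \<Longrightarrow> (\<And>a. a \<in> A \<Longrightarrow> a \<sqsubseteq>\<^bsub>L\<^esub> b) \<Longrightarrow> s \<sqsubseteq>\<^bsub>L\<^esub> b"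
  using assms by (simp_all add: least_def Upper_def)

text \<open>Joins of values at a point are used here as rules about the maps \<open>u\<close>, so
  that later steps need not unfold the set comprehension.\<close>

lemma is_lub_evalD:
  assumes "is_lub L s {u x | u. u \<in> M}"
  shows "\<And>u. u \<in> M \<Longrightarrow> u x \<in> carrier L \<Longrightarrow> u x \<sqsubseteq>\<^bsub>L\<^esub> s"
    and "\<And>b. b \<in> carrier L \<Longrightarrow> (\<And>u. u \<in> M \<Longrightarrow> u x \<sqsubseteq>\<^bsub>L\<^esub> b) \<Longrightarrow> s \<sqsubseteq>\<^bsub>L\<^esub> b"
  using is_lubD(2,3)[OF assms] by blast+

lemma directed_setD:
  assumes "directed_set P D"
  shows "D \<subseteq> carrier P" "D \<noteq> {}"
    "\<And>x y. x \<in> D \<Longrightarrow> y \<in> D \<Longrightarrow> \<exists>z\<in>D. x \<sqsubseteq>\<^bsub>P\<^esub> z \<and> y \<sqsubseteq>\<^bsub>P\<^esub> z"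
  using assms by (auto simp: directed_set_def)

lemma carrier_ScPrecl: "carrier (ScPrecl P) = scott_preclosure_maps P"
  by (simp add: ScPrecl_def)

lemma scott_preclosure_mapsD:
  assumes "f \<in> scott_preclosure_maps P"
  shows "preclosure_map P f" "scott_continuous P P f"
    "\<And>x. x \<in> carrier P \<Longrightarrow> f x \<in> carrier P"
    "\<And>x. x \<in> carrier P \<Longrightarrow> x \<sqsubseteq>\<^bsub>P\<^esub> f x"
    "\<And>x y. x \<in> carrier P \<Longrightarrow> y \<in> carrier P \<Longrightarrow> x \<sqsubseteq>\<^bsub>P\<^esub> y \<Longrightarrow> f x \<sqsubseteq>\<^bsub>P\<^esub> f y"
  using assms by (auto simp: scott_preclosure_maps_def preclosure_map_def isotone_def)

text \<open>Evaluation at \<open>x\<close> is monotone for the pointwise order, so an upper bound of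
  two maps in \<open>D\<close> gives one of their values. In a dcpo the pointwise joins therefore
  exist.\<close>

lemma directed_eval:
  assumes D: "directed_set (ScPrecl P) D" and x: "x \<in> carrier P"
  shows "directed_set P {u x | u. u \<in> D}"
  unfolding directed_set_def
proof (intro conjI ballI)
  show "{u x | u. u \<in> D} \<subseteq> carrier P"
    using directed_setD(1)[OF D] scott_preclosure_mapsD(3)[OF _ x] by (auto simp: carrier_ScPrecl)
  show "{u x | u. u \<in> D} \<noteq> {}"
    using directed_setD(2)[OF D] by blast
  fix a b assume "a \<in> {u x | u. u \<in> D}" "b \<in> {u x | u. u \<in> D}"
  then obtain f g where fg: "f \<in> D" "g \<in> D" "a = f x" "b = g x" by blast
  then obtain k where k: "k \<in> D" "f \<sqsubseteq>\<^bsub>ScPrecl P\<^esub> k" "g \<sqsubseteq>\<^bsub>ScPrecl P\<^esub> k"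
    using directed_setD(3)[OF D] by blast
  then have "a \<sqsubseteq>\<^bsub>P\<^esub> k x" "b \<sqsubseteq>\<^bsub>P\<^esub> k x"
    using x fg by (simp_all add: ScPrecl_def pointwise_le_def)
  then show "\<exists>c\<in>{u x | u. u \<in> D}. a \<sqsubseteq>\<^bsub>P\<^esub> c \<and> b \<sqsubseteq>\<^bsub>P\<^esub> c"
    using k(1) by blast
qed

lemma (in dcpo) directed_join_ScPrecl:
  assumes D: "directed_set (ScPrecl P) D"
  shows "\<exists>h. is_lub (ScPrecl P) h D \<and> (\<forall>x\<in>carrier P. is_lub P (h x) {u x | u. u \<in> D})"
proof -
  \<comment> \<open>\<open>SOME\<close> picks a join of the values, which exists by
    \<open>directed_lub\<close>. The restriction to the carrier makes \<open>h\<close> extensional,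
    as \<open>preclosure_map\<close> demands.\<close>
  define h where "h = (\<lambda>x\<in>carrier P. SOME s. is_lub P s {u x | u. u \<in> D})"
  have DP: "D \<subseteq> scott_preclosure_maps P"
    using directed_setD(1)[OF D] by (simp add: carrier_ScPrecl)
  note u = scott_preclosure_mapsD[OF subsetD[OF DP]]
  have lub: "is_lub P (h x) {u x | u. u \<in> D}" if x: "x \<in> carrier P" for x
    using someI_ex[OF directed_lub[OF directed_eval[OF D x]]] unfolding h_def restrict_apply'[OF x] .
  have hc: "h x \<in> carrier P" if "x \<in> carrier P" for x
    by (rule is_lubD(1)[OF lub[OF that]])
  have ub: "u x \<sqsubseteq> h x" if "x \<in> carrier P" "u \<in> D" for u x
    by (rule is_lub_evalD(1)[OF lub[OF that(1)] that(2) u(3)[OF that(2,1)]])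
  have least: "h x \<sqsubseteq> b" if "x \<in> carrier P" "b \<in> carrier P" "\<And>u. u \<in> D \<Longrightarrow> u x \<sqsubseteq> b" for b x
    using is_lub_evalD(2)[OF lub[OF that(1)] that(2)] that(3) .
  have mono: "h x \<sqsubseteq> h y" if xy: "x \<in> carrier P" "y \<in> carrier P" "x \<sqsubseteq> y" for x y
  proof (rule least[OF xy(1) hc[OF xy(2)]])
    show "u x \<sqsubseteq> h y" if "u \<in> D" for u
      by (rule le_trans[OF u(5)[OF that xy] ub[OF xy(2) that]
            u(3)[OF that xy(1)] u(3)[OF that xy(2)] hc[OF xy(2)]])
  qed
  \<comment> \<open>This is where \<open>D\<close> being nonempty enters: any
    \<open>v \<in> D\<close> gives \<open>x \<sqsubseteq> v x \<sqsubseteq> h x\<close>.\<close>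
  have above: "x \<sqsubseteq> h x" if x: "x \<in> carrier P" for x
  proof -
    obtain v where v: "v \<in> D"
      using directed_setD(2)[OF D] by blast
    show ?thesis
      by (rule le_trans[OF u(4)[OF v x] ub[OF x v] x u(3)[OF v x] hc[OF x]])
  qed
  have pre: "preclosure_map P h"
    using hc mono above weak_partial_order_axioms
    by (auto simp: preclosure_map_def isotone_def h_def)
  have "scott_continuous P P h"
    unfolding scott_continuous_def
  proof (intro conjI allI impI)
    show "h \<in> carrier P \<rightarrow> carrier P" using hc by auto
    fix S s assume S: "directed_set P S \<and> is_lub P s S"
    then have SP: "S \<subseteq> carrier P" by (simp add: directed_setD)
    have sS: "is_lub P s S" using S by simp
    note s = is_lubD(1)[OF sS]
    have hS: "h ` S \<subseteq> carrier P" using SP hc by auto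
    \<comment> \<open>Exchange of joins: it suffices to bound \<open>v s\<close> for each
      \<open>v \<in> D\<close>. By continuity of \<open>v\<close> this is the join of the values
      \<open>v a\<close> with \<open>a \<in> S\<close>, and
      \<open>v a \<sqsubseteq> h a \<sqsubseteq> b\<close>.\<close>
    have "h s \<sqsubseteq> b" if b: "b \<in> carrier P" "\<And>a. a \<in> S \<Longrightarrow> h a \<sqsubseteq> b" for b
    proof (rule least[OF s b(1)])
      fix v assume v: "v \<in> D"
      have vs: "is_lub P (v s) (v ` S)"
        using u(2)[OF v] S by (simp add: scott_continuous_def)
      have "v a \<sqsubseteq> b" if "a \<in> S" for a
      proof -
        have a: "a \<in> carrier P" using SP that by auto
        show ?thesis
          by (rule le_trans[OF ub[OF a v] b(2)[OF that] u(3)[OF v a] hc[OF a] b(1)])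
      qed
      then show "v s \<sqsubseteq> b" using is_lubD(3)[OF vs b(1)] by blast
    qed
    moreover have "h a \<sqsubseteq> h s" if "a \<in> S" for a
      using mono[OF subsetD[OF SP that] s] is_lubD(2)[OF sS that] SP that by blast
    ultimately show "is_lub P (h s) (h ` S)"
      using hc[OF s] by (simp add: is_lub_iff[OF hS])
  qed
  with pre have "h \<in> scott_preclosure_maps P"
    by (simp add: scott_preclosure_maps_def)
  moreover have "pointwise_le P v h" if "v \<in> D" for v
    using ub that by (simp add: pointwise_le_def)
  moreover have "pointwise_le P h k"
    if "k \<in> scott_preclosure_maps P" "\<And>v. v \<in> D \<Longrightarrow> pointwise_le P v k" for k
    unfolding pointwise_le_def
  proof
    fix x assume x: "x \<in> carrier P"
    show "h x \<sqsubseteq> k x"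
      using that(2) x by (intro least scott_preclosure_mapsD(3)[OF that(1)]) (auto simp: pointwise_le_def)
  qed
  ultimately have "is_lub (ScPrecl P) h D"
    unfolding is_lub_iff[OF directed_setD(1)[OF D]] by (simp add: ScPrecl_def)
  then show ?thesis using lub by blast
qed

context partial_order
begin

text \<open>The composite of \<open>f\<close> after \<open>g\<close> bounds both maps:
  \<open>f x \<sqsubseteq> f (g x)\<close> because \<open>g\<close> is ascending and
  \<open>f\<close> monotone, and \<open>g x \<sqsubseteq> f (g x)\<close> because \<open>f\<close>
  is ascending. The unit makes \<open>M\<close> nonempty.\<close>

lemma directed_submonoid_ScPrecl:
  assumes M: "submonoid M (ScPrecl_monoid L)"
  shows "directed_set (ScPrecl L) M"
  unfolding directed_set_def
proof (intro conjI ballI)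
  have MS: "M \<subseteq> scott_preclosure_maps L"
    using submonoid.subset[OF M] by (simp add: ScPrecl_monoid_def)
  then show "M \<subseteq> carrier (ScPrecl L)"
    by (simp add: carrier_ScPrecl)
  show "M \<noteq> {}"
    using submonoid.one_closed[OF M] by auto
  fix f g assume fg: "f \<in> M" "g \<in> M"
  note f = scott_preclosure_mapsD[OF subsetD[OF MS fg(1)]]
    and g = scott_preclosure_mapsD[OF subsetD[OF MS fg(2)]]
  have "compose (carrier L) f g \<in> M"
    using submonoid.m_closed[OF M fg] by (simp add: ScPrecl_monoid_def)
  moreover have "pointwise_le L f (compose (carrier L) f g)" "pointwise_le L g (compose (carrier L) f g)"
    using f g by (auto simp: pointwise_le_def compose_eq)
  ultimately show "\<exists>k\<in>M. f \<sqsubseteq>\<^bsub>ScPrecl L\<^esub> k \<and> g \<sqsubseteq>\<^bsub>ScPrecl L\<^esub> k"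
    by (auto simp: ScPrecl_def)
qed

lemma submonoid_join_idem:
  assumes M: "submonoid M (ScPrecl_monoid L)" and h: "h \<in> scott_preclosure_maps L"
    and lub: "\<And>x. x \<in> carrier L \<Longrightarrow> is_lub L (h x) {u x | u. u \<in> M}"
    and x: "x \<in> carrier L"
  shows "h (h x) = h x"
proof -
  have MS: "M \<subseteq> scott_preclosure_maps L"
    using submonoid.subset[OF M] by (simp add: ScPrecl_monoid_def)
  note u = scott_preclosure_mapsD[OF subsetD[OF MS]] and h' = scott_preclosure_mapsD[OF h]
  have "directed_set L {u x | u. u \<in> M}"
    by (rule directed_eval[OF directed_submonoid_ScPrecl[OF M] x])
  \<comment> \<open>The values \<open>u x\<close> form a directed set with join \<open>h x\<close>,
    so continuity of \<open>h\<close> applies to this set.\<close>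
  with h'(2) lub[OF x] have hh: "is_lub L (h (h x)) (h ` {u x | u. u \<in> M})"
    by (simp add: scott_continuous_def)
  note hx = h'(3)[OF x]
  have "h (v x) \<sqsubseteq> h x" if v: "v \<in> M" for v
  proof (rule is_lub_evalD(2)[OF lub[OF u(3)[OF v x]] hx])
    fix w assume w: "w \<in> M"
    \<comment> \<open>Closure of \<open>M\<close> under composition turns \<open>w (v x)\<close>
      into the value at \<open>x\<close> of a single member of \<open>M\<close>, which lies below
      \<open>h x\<close>.\<close>
    have wv: "compose (carrier L) w v \<in> M"
      using submonoid.m_closed[OF M w v] by (simp add: ScPrecl_monoid_def)
    show "w (v x) \<sqsubseteq> h x"
      using is_lub_evalD(1)[OF lub[OF x] wv u(3)[OF wv x]] x by (simp add: compose_eq)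
  qed
  then have "h (h x) \<sqsubseteq> h x"
    using is_lubD(3)[OF hh hx] by blast
  then show ?thesis
    using h'(4)[OF hx] h'(3)[OF hx] hx by (rule le_antisym)
qed

lemma fixpoints_generated_submonoid:
  assumes "x \<in> fixpoints L G" and "u \<in> generated_submonoid (ScPrecl_monoid L) G"
  shows "u x = x"
proof -
  \<comment> \<open>Membership in \<open>fixpoints\<close> puts \<open>x\<close> in the carrier, so
    neither the restricted identity nor \<open>compose\<close> takes its default value
    \<open>undefined\<close> at \<open>x\<close>.\<close>
  have "foldr (compose (carrier L)) gs (\<lambda>x\<in>carrier L. x) x = x" if "set gs \<subseteq> G" for gs
    using that assms(1) by (induction gs) (auto simp: fixpoints_def compose_eq)
  then show ?thesis
    using assms(2) by (auto simp: generated_submonoid_def ScPrecl_monoid_def)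
qed

text \<open>The argument works with the pointwise description of \<open>h\<close> alone. The
  properties of preclosure maps are applied to the members of the submonoid, not to
  \<open>h\<close>.\<close>

lemma fixpoints_join_generated_submonoid:
  assumes G: "G \<subseteq> carrier (ScPrecl L)"
    and lub: "\<And>x. x \<in> carrier L \<Longrightarrow>
      is_lub L (h x) {u x | u. u \<in> generated_submonoid (ScPrecl_monoid L) G}"
  shows "fixpoints L {h} = fixpoints L G"
proof (intro equalityI subsetI)
  let ?M = "generated_submonoid (ScPrecl_monoid L) G"
  have GM: "G \<subseteq> carrier (ScPrecl_monoid L)"
    using G by (simp add: carrier_ScPrecl ScPrecl_monoid_def)
  note gen = monoid.generated_submonoid_least[OF monoid_ScPrecl GM]
  have "?M \<subseteq> scott_preclosure_maps L"
    using submonoid.subset[OF gen(1)] by (simp add: ScPrecl_monoid_def)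
  note u = scott_preclosure_mapsD[OF subsetD[OF this]]
  show "x \<in> fixpoints L G" if "x \<in> fixpoints L {h}" for x
  proof -
    from that have x: "x \<in> carrier L" "h x = x" by (auto simp: fixpoints_def)
    have "g x = x" if "g \<in> G" for g
    proof -
      have g: "g \<in> ?M" using that gen(2) by blast
      \<comment> \<open>As \<open>g\<close> is itself in the submonoid, \<open>g x\<close> lies
        below \<open>h x\<close>, which equals \<open>x\<close>.\<close>
      have "g x \<sqsubseteq> x"
        using is_lub_evalD(1)[OF lub[OF x(1)] g u(3)[OF g x(1)]] x(2) by simp
      then show ?thesis
        using u(4)[OF g x(1)] u(3)[OF g x(1)] x(1) by (rule le_antisym)
    qed
    then show ?thesis using x by (simp add: fixpoints_def)
  qed
  show "x \<in> fixpoints L {h}" if fx: "x \<in> fixpoints L G" for x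
  proof -
    from fx have x: "x \<in> carrier L" by (simp add: fixpoints_def)
    note ux = fixpoints_generated_submonoid[OF fx]
    \<comment> \<open>The unit of the monoid is a member of the family with value \<open>x\<close>
      at \<open>x\<close>; it yields \<open>x \<sqsubseteq> h x\<close> below.\<close>
    note v = submonoid.one_closed[OF gen(1)]
    have "h x \<sqsubseteq> x"
      by (rule is_lub_evalD(2)[OF lub[OF x] x]) (simp add: ux x)
    moreover have "x \<sqsubseteq> h x"
      using is_lub_evalD(1)[OF lub[OF x] v u(3)[OF v x]] ux[OF v] by simp
    ultimately have "h x = x"
      using is_lubD(1)[OF lub[OF x]] x by (rule le_antisym)
    then show ?thesis using x by (simp add: fixpoints_def)
  qed
qed

end

theorem theorem4p7:
  fixes P :: "('a, 'm) gorder_scheme" and G :: "('a \<Rightarrow> 'a) set"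
  assumes "dcpo P" and "G \<subseteq> carrier (ScPrecl P)"
  shows "let Gstar = generated_submonoid (ScPrecl_monoid P) G in
    directed_set (ScPrecl P) Gstar \<and>
    (\<exists>h. is_lub (ScPrecl P) h Gstar \<and>
         (\<forall>x\<in>carrier P. is_lub P (h x) {u x | u. u \<in> Gstar}) \<and>
         scott_continuous P P h \<and>
         closure_operator P h \<and>
         closure_operator_generated_by P G h \<and>
         fixpoints P {h} = fixpoints P G)"
proof -
  interpret dcpo P by fact
  define M where "M = generated_submonoid (ScPrecl_monoid P) G"
  have "G \<subseteq> carrier (ScPrecl_monoid P)"
    using assms(2) by (simp add: carrier_ScPrecl ScPrecl_monoid_def)
  then have M: "submonoid M (ScPrecl_monoid P)"
    unfolding M_def by (rule monoid.generated_submonoid_least[OF monoid_ScPrecl])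
  note dir = directed_submonoid_ScPrecl[OF M]
  obtain h where h: "is_lub (ScPrecl P) h M"
    and lub: "\<And>x. x \<in> carrier P \<Longrightarrow> is_lub P (h x) {u x | u. u \<in> M}"
    using directed_join_ScPrecl[OF dir] by blast
  \<comment> \<open>A join in \<open>ScPrecl P\<close> lies in its carrier, which supplies the Scott
    continuity of \<open>h\<close> needed for idempotence.\<close>
  have hS: "h \<in> scott_preclosure_maps P"
    using h is_lub_iff[OF directed_setD(1)[OF dir]] by (simp add: carrier_ScPrecl)
  have "closure_operator P h"
    using scott_preclosure_mapsD(1)[OF hS] submonoid_join_idem[OF M hS lub]
    by (simp add: closure_operator_def idempotent_def eq_is_equal)
  moreover have "fixpoints P {h} = fixpoints P G"
    using fixpoints_join_generated_submonoid[OF assms(2), of h] lub by (simp add: M_def)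
  ultimately show ?thesis
    using dir h lub scott_preclosure_mapsD(2)[OF hS]
    unfolding Let_def M_def[symmetric] closure_operator_generated_by_def by blast
qed

end
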